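(* Let $A,\bar A\in\mathbb R^{n\times n}$, $B,\bar B\in\mathbb R^{n\times m}$ be constant matrices, let $H\in\mathbb R^{l\times n}$ have full row rank, and consider the stochastic system $$x(k+1)=[Ax(k)+Bu(k)]+w(k)[\bar A x(k)+\bar B u(k)],\qquad (\ast)$$ with measurement $y(k)=Hx(k)$, where $x(k)\in\mathbb R^n$, $u(k)\in\mathbb R^m$ and $k$ takes values in $[0,T]$, with $T$ finite or infinite. Assume $\operatorname{rank}(\bar B)=n$, let $M\in\mathbb R^{m\times m}$ be an invertible matrix with $\bar BM=[\,I_n\ \ 0\,]$, write $BM=[\,L\ \ F\,]$ with $L\in\mathbb R^{n\times n}$, $F\in\mathbb R^{n\times(m-n)}$, and assume $A-L\bar A$ is invertible. Put $C=(A-L\bar A)^{-1}$, $\bar C=-(A-L\bar A)^{-1}L$, $D=-(A-L\bar A)^{-1}F$. Assume there exist matrices $\mathcal C_1$ and $\bar{\mathcal C}_1$ such that $$HC=\mathcal C_1H,\qquad H\bar C=\bar{\mathcal C}_1H,$$ and put $\mathcal C_1(k)=\mathcal C_1+w(k)\bar{\mathcal C}_1$. Then the following are equivalent: 1. System $(\ast)$ is $H$-partially exactly null controllable. 2. System $(\ast)$ is $H$-partially exactly controllable, that is, for any nonzero $\bar x_1\in\mathbb R^l$ and $\xi_1\in\mathcal S_1$, there exist a positive integer $N$ and a sequence of controllers $\{u(k),k\in[0,N]\}$ in $l^2_{\mathcal F}([0,N],\mathbb R^m)$ such that $Hx(0)=\bar x_1$ and $Hx(N+1)=\xi_1$, where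 $\mathcal S_1$ is the set of $\xi_1\in L^2(\Omega,\mathbb R^l)$ such that the backward stochastic difference equation $$\bar x_1(k)=\mathcal C_1\bar x_1(k+1)+\bar{\mathcal C}_1\bar z_1(k)-\mathcal C_1w(k)\bar z_1(k),\qquad \bar x_1(N+1)=\xi_1,$$ is solvable. 3. There exists a positive integer $N$ such that the Gramian matrix $$\bar G_N=\sum_{i=0}^N E\big[\mathcal C_1(0)\mathcal C_1(1)\cdots\mathcal C_1(i-1)HDD'H'\mathcal C_1'(i-1)\cdots\mathcal C_1'(0)\big]$$ is invertible (the product $\mathcal C_1(0)\cdots\mathcal C_1(i-1)$ is $I_l$ when $i=0$). 4. $\operatorname{rank}(\bar R)=l$, where $\bar R=[\,HD\ \ \mathcal C_1HD\ \ \bar{\mathcal C}_1HD\ \ \mathcal C_1^2HD\ \ \bar{\mathcal C}_1^2HD\ \ \mathcal C_1\bar{\mathcal C}_1HD\ \ \bar{\mathcal C}_1\mathcal C_1HD\ \cdots]$ is the matrix whose blocks are all matrices $WHD$, $W$ running over all finite products (including the empty product $I_l$) of $\mathcal C_1$ and $\bar{\mathcal C}_1$.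
   Context: Prime denotes transpose. The noise $w(k)$ is a sequence of i.i.d. one-dimensional random variables with zero mean and unit variance on a complete probability space $(\Omega,\mathcal F,\mathcal P)$; $\mathcal F(k)=\sigma\{w(0),\dots,w(k)\}$ and $\mathcal F(-1)$ is trivial. $[0,N]=\{0,1,\dots,N\}$. $L^2(\Omega,\mathbb R^s)$ is the space of square integrable $\mathbb R^s$-valued random vectors, and $l^2_{\mathcal F}([0,N],\mathbb R^s)$ is the space of square summable processes $m(k)\in L^2(\Omega,\mathbb R^s)$, $k\in[0,N]$, with $m(k)$ $\mathcal F(k-1)$-adapted for each $k$. $H$-partially exactly null controllable: for any nonzero $\bar x_1\in\mathbb R^l$, there exist a positive integer $N$ and a sequence of controllers $\{u(k),k\in[0,N]\}$ in $l^2_{\mathcal F}([0,N],\mathbb R^m)$ such that $Hx(0)=\bar x_1$ and $Hx(N+1)=0$. Solvability of the backward equation means that it has a solution $(\bar x_1(k),\bar z_1(k))$, $k\in[0,N]$, with $\bar x_1(k),\bar z_1(k)\in L^2(\Omega,\mathbb R^l)$ both $\mathcal F(k-1)$-adapted. *)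

theory Defs
  imports "HOL-Probability.Probability"
begin

text \<open>
  Block notation for matrices with \<open>m\<close> columns.  Index types are unordered, so "the first \<open>n\<close> columns"
  are the ones picked out by an injection \<open>\<iota> :: 'n \<Rightarrow> 'm\<close>.  If \<open>X = [P Q]\<close> with \<open>P\<close> having
  \<open>n\<close> columns, then \<open>left_block \<iota> X\<close> is \<open>P\<close>, and \<open>right_block \<iota> X\<close> is \<open>[0 Q]\<close>, that is,
  \<open>Q\<close> padded by \<open>n\<close> zero columns.  A separate index type for the remaining \<open>m - n\<close> columns
  would be nonempty and so would exclude \<open>m = n\<close>.
\<close>

definition left_block :: "('n \<Rightarrow> 'm) \<Rightarrow> real^'m^'r \<Rightarrow> real^'n^'r"
  where "left_block \<iota> X = (\<chi> i j. X $ i $ \<iota> j)"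

definition right_block :: "('n \<Rightarrow> 'm) \<Rightarrow> real^'m^'r \<Rightarrow> real^'m^'r"
  where "right_block \<iota> X = (\<chi> i j. if j \<in> range \<iota> then 0 else X $ i $ j)"

definition unit_white_noise :: "'a measure \<Rightarrow> (nat \<Rightarrow> 'a \<Rightarrow> real) \<Rightarrow> bool"
  where "unit_white_noise P w \<longleftrightarrow>
    prob_space.indep_vars P (\<lambda>_. borel) w UNIV \<and>
    (\<forall>k. distr P borel (w k) = distr P borel (w 0)) \<and>
    (\<forall>k. integrable P (\<lambda>\<omega>. (w k \<omega>)\<^sup>2)) \<and>
    (\<forall>k. prob_space.expectation P (w k) = 0) \<and>
    (\<forall>k. prob_space.variance P (w k) = 1)"

text \<open>\<open>past P w k\<close> is \<open>\<F>(k - 1) = \<sigma>{w(0), \<dots>, w(k - 1)}\<close>; \<open>past P w 0\<close> is trivial.\<close>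

definition past :: "'a measure \<Rightarrow> (nat \<Rightarrow> 'a \<Rightarrow> real) \<Rightarrow> nat \<Rightarrow> 'a measure"
  where "past P w k = sigma (space P) {w i -` S \<inter> space P | i S. i < k \<and> S \<in> sets borel}"

definition L2 :: "'a measure \<Rightarrow> ('a \<Rightarrow> 'b::euclidean_space) set"
  where "L2 P = {X. X \<in> borel_measurable P \<and> integrable P (\<lambda>\<omega>. (norm (X \<omega>))\<^sup>2)}"

text \<open>The space \<open>l\<^sup>2\<^sub>\<F>([0,N])\<close>; values at times after \<open>N\<close> are unconstrained.\<close>

definition l2_adapted ::
    "'a measure \<Rightarrow> (nat \<Rightarrow> 'a \<Rightarrow> real) \<Rightarrow> nat \<Rightarrow> (nat \<Rightarrow> 'a \<Rightarrow> 'b::euclidean_space) set"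
  where "l2_adapted P w N = {X. \<forall>k\<le>N. X k \<in> L2 P \<and> X k \<in> borel_measurable (past P w k)}"

primrec state ::
    "real^'n^'n \<Rightarrow> real^'n^'n \<Rightarrow> real^'m^'n \<Rightarrow> real^'m^'n \<Rightarrow> (nat \<Rightarrow> 'a \<Rightarrow> real) \<Rightarrow>
     real^'n \<Rightarrow> (nat \<Rightarrow> 'a \<Rightarrow> real^'m) \<Rightarrow> nat \<Rightarrow> 'a \<Rightarrow> real^'n"
  where
    "state A Ab B Bb w x0 u 0 = (\<lambda>\<omega>. x0)"
  | "state A Ab B Bb w x0 u (Suc k) = (\<lambda>\<omega>.
       (A *v state A Ab B Bb w x0 u k \<omega> + B *v u k \<omega>) +
       w k \<omega> *\<^sub>R (Ab *v state A Ab B Bb w x0 u k \<omega> + Bb *v u k \<omega>))"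

text \<open>
  Since \<open>\<F>(-1)\<close> is trivial, the initial state is deterministic.  Only \<open>H x(0)\<close> is prescribed, so
  the initial state itself is existentially quantified.
\<close>

definition steers ::
    "'a measure \<Rightarrow> (nat \<Rightarrow> 'a \<Rightarrow> real) \<Rightarrow> real^'n^'n \<Rightarrow> real^'n^'n \<Rightarrow> real^'m^'n \<Rightarrow> real^'m^'n \<Rightarrow>
     real^'n^'l \<Rightarrow> nat \<Rightarrow> real^'l \<Rightarrow> ('a \<Rightarrow> real^'l) \<Rightarrow> bool"
  where "steers P w A Ab B Bb H N y \<xi> \<longleftrightarrow>
    (\<exists>u \<in> l2_adapted P w N. \<exists>x0. H *v x0 = y \<and>
       (AE \<omega> in P. H *v state A Ab B Bb w x0 u (N + 1) \<omega> = \<xi> \<omega>))"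

definition partially_exactly_null_controllable ::
    "'a measure \<Rightarrow> (nat \<Rightarrow> 'a \<Rightarrow> real) \<Rightarrow> real^'n^'n \<Rightarrow> real^'n^'n \<Rightarrow> real^'m^'n \<Rightarrow> real^'m^'n \<Rightarrow>
     real^'n^'l \<Rightarrow> bool"
  where "partially_exactly_null_controllable P w A Ab B Bb H \<longleftrightarrow>
    (\<forall>y. y \<noteq> 0 \<longrightarrow> (\<exists>N>0. steers P w A Ab B Bb H N y (\<lambda>\<omega>. 0)))"

text \<open>
  Solvability on \<open>[0,N]\<close> of
  \<open>x(k) = C\<^sub>1 x(k+1) + C\<^sub>1\<^sub>b z(k) - C\<^sub>1 w(k) z(k)\<close>, \<open>x(N+1) = \<xi>\<close>.
\<close>

definition bsde_solvable ::
    "'a measure \<Rightarrow> (nat \<Rightarrow> 'a \<Rightarrow> real) \<Rightarrow> real^'l^'l \<Rightarrow> real^'l^'l \<Rightarrow> nat \<Rightarrow> ('a \<Rightarrow> real^'l) \<Rightarrow> bool"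
  where "bsde_solvable P w C1 C1b N \<xi> \<longleftrightarrow>
    (\<exists>x z. x \<in> l2_adapted P w N \<and> z \<in> l2_adapted P w N \<and>
       (AE \<omega> in P. x (N + 1) \<omega> = \<xi> \<omega>) \<and>
       (\<forall>k\<le>N. AE \<omega> in P.
          x k \<omega> = C1 *v x (k + 1) \<omega> + C1b *v z k \<omega> - C1 *v (w k \<omega> *\<^sub>R z k \<omega>)))"

text \<open>The terminal time of the backward equation ranges over all positive horizons.\<close>

definition admissible_targets ::
    "'a measure \<Rightarrow> (nat \<Rightarrow> 'a \<Rightarrow> real) \<Rightarrow> real^'l^'l \<Rightarrow> real^'l^'l \<Rightarrow> ('a \<Rightarrow> real^'l) set"
  where "admissible_targets P w C1 C1b = {\<xi> \<in> L2 P. \<exists>N>0. bsde_solvable P w C1 C1b N \<xi>}"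

definition partially_exactly_controllable ::
    "'a measure \<Rightarrow> (nat \<Rightarrow> 'a \<Rightarrow> real) \<Rightarrow> real^'n^'n \<Rightarrow> real^'n^'n \<Rightarrow> real^'m^'n \<Rightarrow> real^'m^'n \<Rightarrow>
     real^'n^'l \<Rightarrow> real^'l^'l \<Rightarrow> real^'l^'l \<Rightarrow> bool"
  where "partially_exactly_controllable P w A Ab B Bb H C1 C1b \<longleftrightarrow>
    (\<forall>y. y \<noteq> 0 \<longrightarrow> (\<forall>\<xi> \<in> admissible_targets P w C1 C1b.
       \<exists>N>0. steers P w A Ab B Bb H N y \<xi>))"

text \<open>\<open>noise_prod w C1 C1b i \<omega> = C\<^sub>1(0) C\<^sub>1(1) \<cdots> C\<^sub>1(i - 1)\<close>, where \<open>C\<^sub>1(k) = C\<^sub>1 + w(k) C\<^sub>1\<^sub>b\<close>.\<close>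

primrec noise_prod ::
    "(nat \<Rightarrow> 'a \<Rightarrow> real) \<Rightarrow> real^'l^'l \<Rightarrow> real^'l^'l \<Rightarrow> nat \<Rightarrow> 'a \<Rightarrow> real^'l^'l"
  where
    "noise_prod w C1 C1b 0 = (\<lambda>\<omega>. mat 1)"
  | "noise_prod w C1 C1b (Suc i) = (\<lambda>\<omega>. noise_prod w C1 C1b i \<omega> ** (C1 + w i \<omega> *\<^sub>R C1b))"

text \<open>
  A zero-padded \<open>D\<close> may be used here: \<open>D D'\<close> is unaffected by zero columns of \<open>D\<close>.
\<close>

definition gramian ::
    "'a measure \<Rightarrow> (nat \<Rightarrow> 'a \<Rightarrow> real) \<Rightarrow> real^'l^'l \<Rightarrow> real^'l^'l \<Rightarrow> real^'n^'l \<Rightarrow> real^'m^'n \<Rightarrow> nat \<Rightarrow>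
     real^'l^'l"
  where "gramian P w C1 C1b H D N =
    (\<Sum>i=0..N. prob_space.expectation P (\<lambda>\<omega>.
       noise_prod w C1 C1b i \<omega> ** H ** D ** transpose D ** transpose H **
       transpose (noise_prod w C1 C1b i \<omega>)))"

inductive_set words :: "real^'l^'l \<Rightarrow> real^'l^'l \<Rightarrow> (real^'l^'l) set"
  for C1 C1b :: "real^'l^'l"
  where
    "mat 1 \<in> words C1 C1b"
  | "W \<in> words C1 C1b \<Longrightarrow> C1 ** W \<in> words C1 C1b"
  | "W \<in> words C1 C1b \<Longrightarrow> C1b ** W \<in> words C1 C1b"

text \<open>
  The block matrix with all blocks \<open>W H D\<close> has infinitely many columns, so its rank is rendered as
  the dimension of the span of its columns (cf. \<open>column_rank_def\<close> for ordinary matrices).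
\<close>

definition word_rank :: "real^'l^'l \<Rightarrow> real^'l^'l \<Rightarrow> real^'n^'l \<Rightarrow> real^'m^'n \<Rightarrow> nat"
  where "word_rank C1 C1b H D = dim (\<Union>W \<in> words C1 C1b. columns (W ** H ** D))"

end

theory Submission
  imports Defs
begin

text \<open>
  With \<open>Z(k) = H(Ab x(k) + Bb u(k))\<close> and \<open>v(k)\<close> the components of \<open>M\<inverse> u(k)\<close> on which
  \<open>F\<close> acts, the process \<open>X(k) = H x(k)\<close> satisfies
  \<open>X(k) = C\<^sub>1 (X(k+1) - w(k) Z(k)) + C\<^sub>1\<^sub>b Z(k) + E v(k)\<close>, \<open>E = H D\<close>, and \<open>Z\<close>, \<open>v\<close> are free adapted controls.
  The Gramian is \<open>G\<^sub>N = \<Sum>\<^sub>i\<^sub>\<le>\<^sub>N \<Lambda>\<^sup>i(E E')\<close> with \<open>\<Lambda>(Q) = C\<^sub>1 Q C\<^sub>1' + C\<^sub>1\<^sub>b Q C\<^sub>1\<^sub>b'\<close>, and its kernel consists of the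
  vectors annihilated by all \<open>(W E)'\<close> with \<open>W\<close> a word of length at most \<open>N\<close>.

  If \<open>a\<close> is annihilated by all \<open>(W E)'\<close>, then \<open>X(N+1) = 0\<close> forces \<open>a \<bullet> X(k) = 0\<close> for all \<open>k\<close>, since a
  combination \<open>f + w(k) g\<close> with \<open>f, g\<close> in the past of \<open>w(k)\<close> vanishes only if \<open>f\<close> and \<open>g\<close> do.

  Conversely, an admissible target \<open>\<xi>\<close> depends only on \<open>w(0), \<dots>, w(s-1)\<close> for some \<open>s\<close>.  Use zero controls up
  to time \<open>s\<close> and then feed back \<open>v = E' r\<close> and \<open>Z = G C\<^sub>1\<^sub>b' r\<close> with the adjoint process
  \<open>r(k+1) = (C\<^sub>1 + w(k) C\<^sub>1\<^sub>b)' r(k)\<close>; with \<open>G\<^sub>-\<^sub>1 = 0\<close> this gives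
  \<open>X(s+i) = C\<^sub>1\<^sup>n\<^sup>+\<^sup>1\<^sup>-\<^sup>i \<xi> + G\<^sub>n\<^sub>-\<^sub>i r(s+i)\<close> for \<open>i \<le> n+1\<close>, so that \<open>X(s+n+1) = \<xi>\<close>, and invertibility of \<open>G\<^sub>n\<close>
  allows \<open>X(s)\<close> to be matched by the choice of \<open>r(s)\<close>.
\<close>

section \<open>Words, Gramians and block matrices\<close>

lemma matrix_inv_mult:
  assumes "invertible X"
  shows "X ** matrix_inv X = mat 1" "matrix_inv X ** X = mat 1"
  using assms unfolding invertible_def matrix_inv_def by (metis (mono_tags, lifting) someI_ex)+

lemma invertible_iff_ker: "invertible X \<longleftrightarrow> (\<forall>v. X *v v = 0 \<longrightarrow> v = 0)" for X :: "real^'n^'n"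
  by (simp add: invertible_left_inverse matrix_left_invertible_ker)

text \<open>The left kernel of the block matrix with all blocks \<open>W ** E\<close>. Its
  triviality is the condition with which the four statements are compared.\<close>

definition unobservable :: "real^'l^'l \<Rightarrow> real^'l^'l \<Rightarrow> real^'m^'l \<Rightarrow> (real^'l) set"
  where "unobservable C1 C1b E = {a. \<forall>W\<in>words C1 C1b. a v* (W ** E) = 0}"

text \<open>Words grow by left multiplication, and testing \<open>a\<close> on
  \<open>C1 ** W\<close> is testing the row \<open>a v* C1\<close> on \<open>W\<close>.\<close>

lemma unobservableD:
  assumes "a \<in> unobservable C1 C1b E"
  shows "a v* E = 0"
    and "a v* C1 \<in> unobservable C1 C1b E"
    and "a v* C1b \<in> unobservable C1 C1b E"
proof -
  have *: "a v* (W ** E) = 0" if "W \<in> words C1 C1b" for W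
    using assms that unfolding unobservable_def by auto
  show "a v* E = 0"
    using *[OF words.intros(1)] by simp
  show "a v* C1 \<in> unobservable C1 C1b E" "a v* C1b \<in> unobservable C1 C1b E"
    unfolding unobservable_def using *[OF words.intros(2)] *[OF words.intros(3)]
    by (auto simp: vector_matrix_mul_assoc matrix_mul_assoc)
qed

section \<open>Column rank and the unobservable space\<close>

lemma span_eq_UNIV_iff:
  fixes S :: "'a::euclidean_space set"
  shows "span S = UNIV \<longleftrightarrow> (\<forall>a. (\<forall>x\<in>S. a \<bullet> x = 0) \<longrightarrow> a = 0)"
proof
  assume span: "span S = UNIV"
  show "\<forall>a. (\<forall>x\<in>S. a \<bullet> x = 0) \<longrightarrow> a = 0"
  proof (intro allI impI)
    fix a assume "\<forall>x\<in>S. a \<bullet> x = 0"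
    then have "orthogonal a a"
      using span by (intro orthogonal_to_span[of a S]) (simp_all add: orthogonal_def)
    then show "a = 0" by (simp add: orthogonal_def)
  qed
next
  assume triv: "\<forall>a. (\<forall>x\<in>S. a \<bullet> x = 0) \<longrightarrow> a = 0"
  show "span S = UNIV"
  proof (rule ccontr)
    assume "span S \<noteq> UNIV"
    then obtain a where "a \<noteq> 0" "\<forall>x\<in>span S. a \<bullet> x = 0"
      using span_not_UNIV_orthogonal by blast
    with triv span_base[of _ S] show False by blast
  qed
qed

text \<open>Full rank means that no nonzero vector is orthogonal to all columns, and orthogonality
  to the columns of \<open>X\<close> is \<open>a v* X = 0\<close>.\<close>

lemma word_rank_full_iff:
  fixes C1 C1b :: "real^'l^'l" and H :: "real^'n^'l" and D :: "real^'m^'n"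
  shows "word_rank C1 C1b H D = CARD('l) \<longleftrightarrow> unobservable C1 C1b (H ** D) = {0}"
proof -
  let ?S = "\<Union>W\<in>words C1 C1b. columns (W ** H ** D)"
  have column: "(\<forall>x\<in>columns X. a \<bullet> x = 0) \<longleftrightarrow> a v* X = 0" for a :: "real^'l" and X :: "real^'m^'l"
  proof -
    have "a \<bullet> column i X = (a v* X) $ i" for i
      by (simp add: column_def inner_vec_def vector_matrix_mult_def)
    moreover have "columns X = range (\<lambda>i. column i X)"
      by (auto simp: columns_def)
    ultimately show ?thesis by (simp add: vec_eq_iff[of "a v* X"])
  qed
  have orth: "(\<forall>x\<in>?S. a \<bullet> x = 0) \<longleftrightarrow> a \<in> unobservable C1 C1b (H ** D)" for a
    unfolding unobservable_def matrix_mul_assoc by (simp add: column)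
  have "word_rank C1 C1b H D = CARD('l) \<longleftrightarrow> span ?S = UNIV"
    unfolding word_rank_def using dim_eq_full[of ?S] by simp
  also have "\<dots> \<longleftrightarrow> (\<forall>a. (\<forall>x\<in>?S. a \<bullet> x = 0) \<longrightarrow> a = 0)"
    by (rule span_eq_UNIV_iff)
  also have "\<dots> \<longleftrightarrow> unobservable C1 C1b (H ** D) = {0}"
    unfolding orth by (auto simp: unobservable_def)
  finally show ?thesis .
qed

section \<open>The Lyapunov operator and the kernels of its Gramians\<close>

definition lyap :: "real^'l^'l \<Rightarrow> real^'l^'l \<Rightarrow> real^'l^'l \<Rightarrow> real^'l^'l"
  where "lyap C1 C1b Q = C1 ** Q ** transpose C1 + C1b ** Q ** transpose C1b"

text \<open>The sum has \<open>n\<close> terms, so horizon \<open>N\<close> corresponds to index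
  \<open>Suc N\<close>, and index \<open>0\<close> gives the zero matrix in which the feedback
  recursion ends.\<close>

definition word_gramian :: "real^'l^'l \<Rightarrow> real^'l^'l \<Rightarrow> real^'m^'l \<Rightarrow> nat \<Rightarrow> real^'l^'l"
  where "word_gramian C1 C1b E n = (\<Sum>i<n. (lyap C1 C1b ^^ i) (E ** transpose E))"

lemma lyap_mult: "lyap C1 C1b Q *v v = C1 *v (Q *v (v v* C1)) + C1b *v (Q *v (v v* C1b))"
  by (simp add: lyap_def matrix_vector_mult_add_rdistrib flip: matrix_vector_mul_assoc)

lemma lyap_sum: "lyap C1 C1b (\<Sum>i<n::nat. f i) = (\<Sum>i<n. lyap C1 C1b (f i))"
proof (induction n)
  case 0
  have "lyap C1 C1b 0 *v v = 0" for v
    by (simp add: lyap_mult)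
  then show ?case by (simp add: matrix_eq)
next
  case (Suc n)
  have "lyap C1 C1b (X + Y) *v v = (lyap C1 C1b X + lyap C1 C1b Y) *v v" for X Y v
    by (simp add: lyap_mult matrix_vector_mult_add_rdistrib matrix_vector_right_distrib)
  then have "lyap C1 C1b (X + Y) = lyap C1 C1b X + lyap C1 C1b Y" for X Y
    by (simp add: matrix_eq)
  with Suc show ?case by simp
qed

lemma word_gramian_0 [simp]: "word_gramian C1 C1b E 0 = 0"
  by (simp add: word_gramian_def)

lemma word_gramian_Suc:
  "word_gramian C1 C1b E (Suc n) = E ** transpose E + lyap C1 C1b (word_gramian C1 C1b E n)"
  by (simp add: word_gramian_def lyap_sum sum.lessThan_Suc_shift del: sum.lessThan_Suc)

text \<open>The vectors annihilated by all \<open>(W E)'\<close> with \<open>W\<close> a word of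
  exactly \<open>i\<close> factors; recursion on the first factor replaces a notion of word
  length.\<close>

primrec vanishing :: "real^'l^'l \<Rightarrow> real^'l^'l \<Rightarrow> real^'m^'l \<Rightarrow> nat \<Rightarrow> (real^'l) set"
  where
    "vanishing C1 C1b E 0 = {a. a v* E = 0}"
  | "vanishing C1 C1b E (Suc i) = {a. a v* C1 \<in> vanishing C1 C1b E i \<and>
                                       a v* C1b \<in> vanishing C1 C1b E i}"

lemma subspace_vanishing: "subspace (vanishing C1 C1b E i)"
  by (induction i)
     (auto simp: subspace_def vector_matrix_left_distrib scaleR_vector_matrix_assoc)

lemma unobservable_eq: "unobservable C1 C1b E = (\<Inter>i. vanishing C1 C1b E i)"
proof (intro set_eqI iffI)
  fix a assume "a \<in> unobservable C1 C1b E"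
  then have "a \<in> vanishing C1 C1b E i" for i
    by (induction i arbitrary: a) (auto dest: unobservableD)
  then show "a \<in> (\<Inter>i. vanishing C1 C1b E i)" by auto
next
  fix a assume a: "a \<in> (\<Inter>i. vanishing C1 C1b E i)"
  \<comment> \<open>The index must serve all vectors at once, because the induction applies the
    claim to \<open>a v* C1\<close> and \<open>a v* C1b\<close>.\<close>
  have "\<exists>i. \<forall>a \<in> vanishing C1 C1b E i. a v* (W ** E) = 0" if "W \<in> words C1 C1b" for W
    using that
  proof induction
    case 1
    have "\<forall>a \<in> vanishing C1 C1b E 0. a v* (mat 1 ** E) = 0" by simp
    then show ?case by blast
  next
    case (2 W)
    then obtain i where i: "\<forall>a \<in> vanishing C1 C1b E i. a v* (W ** E) = 0" by blast
    have "\<forall>a \<in> vanishing C1 C1b E (Suc i). a v* (C1 ** W ** E) = 0"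
      using i by (simp flip: vector_matrix_mul_assoc)
    then show ?case by blast
  next
    case (3 W)
    then obtain i where i: "\<forall>a \<in> vanishing C1 C1b E i. a v* (W ** E) = 0" by blast
    have "\<forall>a \<in> vanishing C1 C1b E (Suc i). a v* (C1b ** W ** E) = 0"
      using i by (simp flip: vector_matrix_mul_assoc)
    then show ?case by blast
  qed
  with a show "a \<in> unobservable C1 C1b E"
    unfolding unobservable_def by blast
qed

text \<open>The quadratic form of the next iterate at \<open>a\<close> is the sum of the current
  forms at \<open>a v* C1\<close> and \<open>a v* C1b\<close>; for \<open>i = 0\<close> it is the
  squared norm of \<open>a v* E\<close>. Sign and zero set thus pass through the induction.\<close>

lemma lyap_power_form:
  fixes E :: "real^'m^'l"
  shows "a \<bullet> ((lyap C1 C1b ^^ i) (E ** transpose E) *v a) \<ge> 0"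
    and "a \<bullet> ((lyap C1 C1b ^^ i) (E ** transpose E) *v a) = 0 \<longleftrightarrow> a \<in> vanishing C1 C1b E i"
    and "a \<in> vanishing C1 C1b E i \<Longrightarrow> (lyap C1 C1b ^^ i) (E ** transpose E) *v a = 0"
proof (induction i arbitrary: a)
  case 0
  have eq: "v \<bullet> (E ** transpose E *v v) = (v v* E) \<bullet> (v v* E)" for v
    by (simp add: dot_lmul_matrix flip: matrix_vector_mul_assoc)
  {
    case 1
    show ?case using eq[of a] by simp
  next
    case 2
    show ?case using eq[of a] by simp
  next
    case 3
    then show ?case by (simp flip: matrix_vector_mul_assoc)
  }
next
  case (Suc i)
  define f where "f v = v \<bullet> ((lyap C1 C1b ^^ i) (E ** transpose E) *v v)" for v
  have split: "v \<bullet> ((lyap C1 C1b ^^ Suc i) (E ** transpose E) *v v) = f (v v* C1) + f (v v* C1b)" for v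
    by (simp add: lyap_mult inner_right_distrib f_def flip: dot_lmul_matrix)
  have nonneg: "f v \<ge> 0" and zero: "f v = 0 \<longleftrightarrow> v \<in> vanishing C1 C1b E i" for v
    using Suc.IH(1,2) unfolding f_def by auto
  {
    case 1
    show ?case unfolding split using nonneg by simp
  next
    case 2
    show ?case unfolding split by (simp add: add_nonneg_eq_0_iff nonneg zero)
  next
    case 3
    then show ?case by (simp add: lyap_mult Suc.IH(3))
  }
qed

lemma word_gramian_kernel:
  "word_gramian C1 C1b E n *v a = 0 \<longleftrightarrow> (\<forall>i<n. a \<in> vanishing C1 C1b E i)"
proof
  have sum: "word_gramian C1 C1b E n *v a = (\<Sum>i<n. (lyap C1 C1b ^^ i) (E ** transpose E) *v a)"
    unfolding word_gramian_def
    by (induction n) (auto simp: matrix_vector_mult_add_rdistrib)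
  {
    assume "word_gramian C1 C1b E n *v a = 0"
    then have "(\<Sum>i<n. a \<bullet> ((lyap C1 C1b ^^ i) (E ** transpose E) *v a)) = 0"
      unfolding sum by (simp flip: inner_sum_right)
    then show "\<forall>i<n. a \<in> vanishing C1 C1b E i"
      by (simp add: sum_nonneg_eq_0_iff lyap_power_form)
  next
    assume "\<forall>i<n. a \<in> vanishing C1 C1b E i"
    then show "word_gramian C1 C1b E n *v a = 0"
      unfolding sum by (simp add: lyap_power_form(3))
  }
qed

text \<open>The kernels of the Gramians decrease, so they are constant from the index at which their
  dimension is least.\<close>

lemma word_gramian_invertible_iff:
  "(\<exists>N>0. invertible (word_gramian C1 C1b E (Suc N))) \<longleftrightarrow> unobservable C1 C1b E = {0}"
proof
  assume "\<exists>N>0. invertible (word_gramian C1 C1b E (Suc N))"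
  then obtain N where "invertible (word_gramian C1 C1b E (Suc N))" by blast
  then have "a = 0" if "a \<in> unobservable C1 C1b E" for a
    using that unfolding invertible_iff_ker word_gramian_kernel unobservable_eq by auto
  then show "unobservable C1 C1b E = {0}"
    by (auto simp: unobservable_def)
next
  assume U: "unobservable C1 C1b E = {0}"
  define K where "K n = {a. word_gramian C1 C1b E n *v a = 0}" for n
  have K: "K n = (\<Inter>i<n. vanishing C1 C1b E i)" for n
    by (auto simp: K_def word_gramian_kernel)
  have sub: "subspace (K n)" for n
    unfolding K by (intro subspace_Int subspace_vanishing)
  obtain N where N: "\<And>n. dim (K N) \<le> dim (K n)"
    using ex_has_least_nat[of "\<lambda>_. True" 0 "\<lambda>n. dim (K n)"] by auto
  have "K N \<subseteq> K n" for n
  proof -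
    have le: "K (max N n) \<subseteq> K N" "K (max N n) \<subseteq> K n" unfolding K by auto
    then have "K (max N n) = K N"
      using N sub by (intro subspace_dim_equal) auto
    with le show ?thesis by simp
  qed
  \<comment> \<open>With index \<open>Suc (Suc N)\<close> the horizon is \<open>Suc N\<close>, which
    is positive as required.\<close>
  then have "K (Suc (Suc N)) \<subseteq> unobservable C1 C1b E"
    unfolding unobservable_eq K by fastforce
  with U have "invertible (word_gramian C1 C1b E (Suc (Suc N)))"
    unfolding invertible_iff_ker K_def by auto
  then show "\<exists>N>0. invertible (word_gramian C1 C1b E (Suc N))" by blast
qed

section \<open>Block products and vectors assembled from blocks\<close>

lemma block_mult:
  fixes X :: "real^'m^'r"
  assumes "inj \<iota>"
  shows "X *v a = left_block \<iota> X *v (\<chi> i. a $ \<iota> i) + right_block \<iota> X *v a"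
proof (subst vec_eq_iff, rule allI)
  fix r
  have "(\<Sum>j\<in>UNIV. X $ r $ j * a $ j)
      = (\<Sum>j\<in>range \<iota>. X $ r $ j * a $ j) + (\<Sum>j\<in>-range \<iota>. X $ r $ j * a $ j)"
    by (subst sum.union_disjoint[symmetric]) (simp_all add: Compl_partition)
  also have "(\<Sum>j\<in>range \<iota>. X $ r $ j * a $ j) = (\<Sum>i\<in>UNIV. X $ r $ \<iota> i * a $ \<iota> i)"
    using assms by (simp add: sum.reindex)
  also have "(\<Sum>j\<in>-range \<iota>. X $ r $ j * a $ j) = (\<Sum>j\<in>UNIV. (if j \<in> range \<iota> then 0 else X $ r $ j) * a $ j)"
    by (rule sum.mono_neutral_cong_left) auto
  finally show "(X *v a) $ r = (left_block \<iota> X *v (\<chi> i. a $ \<iota> i) + right_block \<iota> X *v a) $ r"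
    by (simp add: matrix_vector_mult_def left_block_def right_block_def)
qed

text \<open>Controls are assembled from their two free parts in this way, without an index type for
  the second block.\<close>

definition merge_vec :: "('n \<Rightarrow> 'm) \<Rightarrow> real^'n \<Rightarrow> real^'m \<Rightarrow> real^'m"
  where "merge_vec \<iota> p v = (\<chi> j. if j \<in> range \<iota> then p $ inv \<iota> j else v $ j)"

lemma linear_merge_vec: "linear (\<lambda>p. merge_vec \<iota> p 0)" "linear (merge_vec \<iota> 0)"
  by (auto intro!: linearI simp: merge_vec_def vec_eq_iff)

lemma merge_vec_split: "merge_vec \<iota> p v = merge_vec \<iota> p 0 + merge_vec \<iota> 0 v"
  by (simp add: merge_vec_def vec_eq_iff)

lemma mult_merge_vec:
  fixes X :: "real^'m^'r"
  assumes "inj \<iota>"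
  shows "X *v merge_vec \<iota> p v = left_block \<iota> X *v p + right_block \<iota> X *v v"
proof -
  have "(\<chi> i. merge_vec \<iota> p v $ \<iota> i) = p"
    using assms by (simp add: merge_vec_def vec_eq_iff)
  moreover have "right_block \<iota> X *v merge_vec \<iota> p v = right_block \<iota> X *v v"
    unfolding matrix_vector_mult_def
    by (auto simp: vec_eq_iff right_block_def merge_vec_def intro!: sum.cong)
  ultimately show ?thesis
    using block_mult[OF assms, of X "merge_vec \<iota> p v"] by simp
qed

section \<open>White noise and adapted square-integrable processes\<close>

locale white_noise = prob_space P for P :: "'a measure" +
  fixes w :: "nat \<Rightarrow> 'a \<Rightarrow> real"
  assumes noise: "unit_white_noise P w"
begin

section \<open>The noise filtration and moments of noise times past\<close>

lemma noise_indep: "indep_vars (\<lambda>_. borel) w UNIV"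
  using noise unfolding unit_white_noise_def by blast

lemma noise_measurable [measurable]: "w k \<in> borel_measurable P"
  using noise_indep unfolding indep_vars_def by auto

lemma space_past [simp]: "space (past P w k) = space P"
  unfolding past_def by (rule space_measure_of) auto

lemma sets_past: "sets (past P w k) =
    sigma_sets (space P) {w i -` S \<inter> space P | i S. i < k \<and> S \<in> sets borel}"
  unfolding past_def by (rule sets_measure_of) auto

lemma past_mono: "i \<le> j \<Longrightarrow> sets (past P w i) \<subseteq> sets (past P w j)"
  unfolding sets_past by (rule sigma_sets_subseteq) (blast intro: less_le_trans)

lemma measurable_past_mono: "f \<in> borel_measurable (past P w i) \<Longrightarrow> i \<le> j \<Longrightarrow> f \<in> borel_measurable (past P w j)"
  using past_mono[of i j] unfolding measurable_def by auto

lemma measurable_past: "f \<in> borel_measurable (past P w i) \<Longrightarrow> f \<in> borel_measurable P"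
proof -
  have "sets (past P w i) \<subseteq> sets P"
    unfolding sets_past by (rule sets.sigma_sets_subset) auto
  then show "f \<in> borel_measurable (past P w i) \<Longrightarrow> f \<in> borel_measurable P"
    unfolding measurable_def by auto
qed

lemma noise_measurable_past: "i < k \<Longrightarrow> w i \<in> borel_measurable (past P w k)"
  unfolding measurable_def by (auto simp: sets_past intro!: sigma_sets.Basic)

text \<open>The index sets \<open>{k}\<close> and \<open>{..<k}\<close> are disjoint, so the
  sigma-algebras generated over them are independent; the second is \<open>past P w k\<close>, which
  contains the one generated by \<open>g\<close>.\<close>

lemma indep_past_noise:
  fixes g :: "'a \<Rightarrow> real"
  assumes g: "g \<in> borel_measurable (past P w k)"
  shows "indep_var borel (w k) borel g"
proof -
  let ?E = "\<lambda>i. {w i -` A \<inter> space P | A. A \<in> sets borel}"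
  define I where "I b = (if b then {k} else {..<k})" for b
  have ind: "indep_sets ?E (\<Union>b\<in>UNIV. I b)"
    using noise_indep unfolding indep_vars_def2 by (blast intro: indep_sets_mono_index)
  have "indep_sets (\<lambda>b. sigma_sets (space P) (\<Union>i\<in>I b. ?E i)) UNIV"
  proof (rule indep_sets_collect_sigma[OF ind])
    show "Int_stable (?E i)" for i
    proof (rule Int_stableI, safe)
      fix A B :: "real set" assume "A \<in> sets borel" "B \<in> sets borel"
      then show "\<exists>S. (w i -` A \<inter> space P) \<inter> (w i -` B \<inter> space P) = w i -` S \<inter> space P \<and> S \<in> sets borel"
        by (intro exI[of _ "A \<inter> B"]) auto
    qed
    show "disjoint_family_on I UNIV"
      unfolding disjoint_family_on_def I_def by auto
  qed
  then have "indep_sets (case_bool (sigma_sets (space P) (?E k)) (sigma_sets (space P) {g -` A \<inter> space P | A. A \<in> sets borel})) UNIV"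
  proof (rule indep_sets_mono_sets)
    fix b :: bool
    have past: "sigma_sets (space P) (\<Union>i\<in>I False. ?E i) = sets (past P w k)"
      unfolding sets_past I_def by (rule arg_cong[where f="sigma_sets _"]) auto
    have "sigma_sets (space P) {g -` A \<inter> space P | A. A \<in> sets borel} \<subseteq> sets (past P w k)"
      using g sets.sigma_sets_subset[of "{g -` A \<inter> space P | A. A \<in> sets borel}" "past P w k"]
      unfolding measurable_def by auto
    with past show "case_bool (sigma_sets (space P) (?E k)) (sigma_sets (space P) {g -` A \<inter> space P | A. A \<in> sets borel}) b
        \<subseteq> sigma_sets (space P) (\<Union>i\<in>I b. ?E i)"
      by (cases b) (simp_all add: I_def)
  qed
  then have "indep_set (sigma_sets (space P) (?E k)) (sigma_sets (space P) {g -` A \<inter> space P | A. A \<in> sets borel})"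
    unfolding indep_set_def .
  with measurable_past[OF g] show ?thesis
    unfolding indep_var_eq by simp
qed

lemma noise_integrable: "integrable P (w k)" "integrable P (\<lambda>\<omega>. (w k \<omega>)\<^sup>2)"
  and noise_expectation: "expectation (w k) = 0" "expectation (\<lambda>\<omega>. (w k \<omega>)\<^sup>2) = 1"
proof -
  show sq: "integrable P (\<lambda>\<omega>. (w k \<omega>)\<^sup>2)" and ex: "expectation (w k) = 0"
    using noise unfolding unit_white_noise_def by blast+
  show "integrable P (w k)"
    by (rule square_integrable_imp_integrable[OF _ sq]) simp
  show "expectation (\<lambda>\<omega>. (w k \<omega>)\<^sup>2) = 1"
    using noise ex unfolding unit_white_noise_def by (metis (no_types, lifting) Bochner_Integration.integral_cong diff_zero)
qed

text \<open>Each coordinate of \<open>g\<close> is independent of \<open>w k\<close>, so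
  expectations factorise, with mean zero and second moment one for the noise.\<close>

lemma
  fixes g :: "'a \<Rightarrow> 'b::euclidean_space"
  assumes g: "g \<in> borel_measurable (past P w k)" "integrable P g"
  shows noise_times_integrable: "integrable P (\<lambda>\<omega>. w k \<omega> *\<^sub>R g \<omega>)"
    and noise_times_expectation: "expectation (\<lambda>\<omega>. w k \<omega> *\<^sub>R g \<omega>) = 0"
    and noise_square_times_integrable: "integrable P (\<lambda>\<omega>. (w k \<omega>)\<^sup>2 *\<^sub>R g \<omega>)"
    and noise_square_times_expectation: "expectation (\<lambda>\<omega>. (w k \<omega>)\<^sup>2 *\<^sub>R g \<omega>) = expectation g"
proof -
  have gb: "(\<lambda>\<omega>. g \<omega> \<bullet> b) \<in> borel_measurable (past P w k)" "integrable P (\<lambda>\<omega>. g \<omega> \<bullet> b)" for b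
    using g by auto
  have sq: "indep_var borel (\<lambda>\<omega>. (w k \<omega>)\<^sup>2) borel (\<lambda>\<omega>. g \<omega> \<bullet> b)" for b
    using indep_var_compose[OF indep_past_noise[OF gb(1)[of b]], of "\<lambda>x. x\<^sup>2" borel id borel]
    by (simp add: comp_def)
  note i1 = indep_var_integrable[OF indep_past_noise[OF gb(1)] noise_integrable(1) gb(2)]
  note i2 = indep_var_integrable[OF sq noise_integrable(2) gb(2)]
  note e1 = indep_var_lebesgue_integral[OF indep_past_noise[OF gb(1)] noise_integrable(1) gb(2)]
  note e2 = indep_var_lebesgue_integral[OF sq noise_integrable(2) gb(2)]
  have eq1: "(\<lambda>\<omega>. w k \<omega> *\<^sub>R g \<omega>) = (\<lambda>\<omega>. \<Sum>b\<in>Basis. (w k \<omega> * (g \<omega> \<bullet> b)) *\<^sub>R b)"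
    using euclidean_representation[of "w k \<omega> *\<^sub>R g \<omega>" for \<omega>] by (simp del: euclidean_representation)
  have eq2: "(\<lambda>\<omega>. (w k \<omega>)\<^sup>2 *\<^sub>R g \<omega>) = (\<lambda>\<omega>. \<Sum>b\<in>Basis. ((w k \<omega>)\<^sup>2 * (g \<omega> \<bullet> b)) *\<^sub>R b)"
    using euclidean_representation[of "(w k \<omega>)\<^sup>2 *\<^sub>R g \<omega>" for \<omega>] by (simp del: euclidean_representation)
  show w1: "integrable P (\<lambda>\<omega>. w k \<omega> *\<^sub>R g \<omega>)"
    unfolding eq1 by (intro Bochner_Integration.integrable_sum integrable_scaleR_left i1)
  show w2: "integrable P (\<lambda>\<omega>. (w k \<omega>)\<^sup>2 *\<^sub>R g \<omega>)"
    unfolding eq2 by (intro Bochner_Integration.integrable_sum integrable_scaleR_left i2)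
  show "expectation (\<lambda>\<omega>. w k \<omega> *\<^sub>R g \<omega>) = 0"
    by (rule euclidean_eqI)
       (simp flip: integral_inner_left[OF w1] add: e1 noise_expectation)
  show "expectation (\<lambda>\<omega>. (w k \<omega>)\<^sup>2 *\<^sub>R g \<omega>) = expectation g"
    by (rule euclidean_eqI)
       (simp flip: integral_inner_left[OF w2] integral_inner_left[OF g(2)] add: e2 noise_expectation)
qed

section \<open>Square-integrable variables adapted to the past\<close>

definition adapted_L2 :: "nat \<Rightarrow> ('a \<Rightarrow> 'b::euclidean_space) set"
  where "adapted_L2 k = L2 P \<inter> borel_measurable (past P w k)"

lemma l2_adapted_iff: "X \<in> l2_adapted P w N \<longleftrightarrow> (\<forall>k\<le>N. X k \<in> adapted_L2 k)"
  unfolding l2_adapted_def adapted_L2_def by auto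

lemma adapted_L2_iff:
  "f \<in> adapted_L2 k \<longleftrightarrow> f \<in> borel_measurable (past P w k) \<and> integrable P (\<lambda>\<omega>. (norm (f \<omega>))\<^sup>2)"
  unfolding adapted_L2_def L2_def by (auto intro: measurable_past)

lemma adapted_L2_mono: "f \<in> adapted_L2 i \<Longrightarrow> i \<le> j \<Longrightarrow> f \<in> adapted_L2 j"
  unfolding adapted_L2_iff by (auto intro: measurable_past_mono)

lemma adapted_L2_const [intro, simp]: "(\<lambda>\<omega>. c) \<in> adapted_L2 k"
  unfolding adapted_L2_iff by auto

lemma adapted_L2_add [intro]:
  assumes "f \<in> adapted_L2 k" "g \<in> adapted_L2 k"
  shows "(\<lambda>\<omega>. f \<omega> + g \<omega>) \<in> adapted_L2 k"
  unfolding adapted_L2_iff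
proof
  have m: "f \<in> borel_measurable (past P w k)" "g \<in> borel_measurable (past P w k)"
    using assms unfolding adapted_L2_iff by auto
  then show "(\<lambda>\<omega>. f \<omega> + g \<omega>) \<in> borel_measurable (past P w k)" by simp
  \<comment> \<open>Parallelogram law: the two sides differ by the square of
    \<open>norm (x - y)\<close>.\<close>
  have bound: "(norm (x + y))\<^sup>2 \<le> 2 * (norm x)\<^sup>2 + 2 * (norm y)\<^sup>2" for x y :: 'b
    using dot_norm[of x y] dot_norm_neg[of x y] by (smt (verit) zero_le_power2 field_sum_of_halves)
  have "integrable P (\<lambda>\<omega>. 2 * (norm (f \<omega>))\<^sup>2 + 2 * (norm (g \<omega>))\<^sup>2)"
    using assms unfolding adapted_L2_iff by auto
  then show "integrable P (\<lambda>\<omega>. (norm (f \<omega> + g \<omega>))\<^sup>2)"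
  proof (rule Bochner_Integration.integrable_bound)
    show "(\<lambda>\<omega>. (norm (f \<omega> + g \<omega>))\<^sup>2) \<in> borel_measurable P"
      using m[THEN measurable_past] by simp
  qed (use bound in auto)
qed

lemma adapted_L2_linear:
  assumes "linear h" "f \<in> adapted_L2 k"
  shows "(\<lambda>\<omega>. h (f \<omega>)) \<in> adapted_L2 k"
  unfolding adapted_L2_iff
proof
  have h: "h \<in> borel_measurable borel"
    using linear_continuous_on[of h UNIV] assms(1)
    by (auto simp: linear_conv_bounded_linear intro: borel_measurable_continuous_onI)
  have m: "f \<in> borel_measurable (past P w k)"
    using assms unfolding adapted_L2_iff by auto
  from measurable_compose[OF m h] show hf: "(\<lambda>\<omega>. h (f \<omega>)) \<in> borel_measurable (past P w k)" .
  obtain B where B: "\<And>x. norm (h x) \<le> B * norm x"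
    using linear_bounded[OF assms(1)] by auto
  have "integrable P (\<lambda>\<omega>. B\<^sup>2 * (norm (f \<omega>))\<^sup>2)"
    using assms unfolding adapted_L2_iff by auto
  then show "integrable P (\<lambda>\<omega>. (norm (h (f \<omega>)))\<^sup>2)"
  proof (rule Bochner_Integration.integrable_bound)
    show "(\<lambda>\<omega>. (norm (h (f \<omega>)))\<^sup>2) \<in> borel_measurable P"
      using hf[THEN measurable_past] by simp
    show "AE \<omega> in P. norm ((norm (h (f \<omega>)))\<^sup>2) \<le> norm (B\<^sup>2 * (norm (f \<omega>))\<^sup>2)"
      using power_mono[OF B, of _ 2] by (auto simp: power_mult_distrib)
  qed
qed

lemma adapted_L2_mult [intro]: "f \<in> adapted_L2 k \<Longrightarrow> (\<lambda>\<omega>. (A :: real^'m^'n) *v f \<omega>) \<in> adapted_L2 k"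
  using adapted_L2_linear[of "(*v) A" f k] by simp

lemma adapted_L2_diff [intro]:
  "f \<in> adapted_L2 k \<Longrightarrow> g \<in> adapted_L2 k \<Longrightarrow> (\<lambda>\<omega>. f \<omega> - g \<omega>) \<in> adapted_L2 k"
  using adapted_L2_add[of f k "\<lambda>\<omega>. - g \<omega>"] adapted_L2_linear[of uminus g k]
  by (simp add: linear_uminus)

text \<open>By independence the second moments of \<open>w k\<close> and \<open>f\<close> multiply.
  The index grows by one because \<open>w k\<close> belongs to the past only from
  \<open>Suc k\<close> on.\<close>

lemma adapted_L2_noise [intro]:
  assumes "f \<in> adapted_L2 k"
  shows "(\<lambda>\<omega>. w k \<omega> *\<^sub>R f \<omega>) \<in> adapted_L2 (Suc k)"
  unfolding adapted_L2_iff
proof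
  have m: "f \<in> borel_measurable (past P w k)" and i: "integrable P (\<lambda>\<omega>. (norm (f \<omega>))\<^sup>2)"
    using assms unfolding adapted_L2_iff by auto
  have "f \<in> borel_measurable (past P w (Suc k))"
    using m by (rule measurable_past_mono) simp
  then show "(\<lambda>\<omega>. w k \<omega> *\<^sub>R f \<omega>) \<in> borel_measurable (past P w (Suc k))"
    using noise_measurable_past[of k "Suc k"] by simp
  show "integrable P (\<lambda>\<omega>. (norm (w k \<omega> *\<^sub>R f \<omega>))\<^sup>2)"
    using noise_square_times_integrable[OF _ i, of k] m by (simp add: power_mult_distrib)
qed

text \<open>Orthogonality of \<open>f\<close> and \<open>w(k) g\<close>: the square of the sum has expectation \<open>E f\<^sup>2 + E g\<^sup>2\<close>.\<close>

lemma AE_zero_if_noise_combination_zero: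
  fixes f g :: "'a \<Rightarrow> real"
  assumes f: "f \<in> adapted_L2 k" and g: "g \<in> adapted_L2 k"
    and zero: "AE \<omega> in P. f \<omega> + w k \<omega> * g \<omega> = 0"
  shows "AE \<omega> in P. f \<omega> = 0 \<and> g \<omega> = 0"
proof -
  have m: "f \<in> borel_measurable (past P w k)" "g \<in> borel_measurable (past P w k)"
    and i: "integrable P (\<lambda>\<omega>. (f \<omega>)\<^sup>2)" "integrable P (\<lambda>\<omega>. (g \<omega>)\<^sup>2)"
    using f g unfolding adapted_L2_iff by auto
  note mP [measurable] = m[THEN measurable_past]
  have fg: "integrable P (\<lambda>\<omega>. f \<omega> * g \<omega>)"
  proof (rule Bochner_Integration.integrable_bound)
    show "integrable P (\<lambda>\<omega>. (f \<omega>)\<^sup>2 + (g \<omega>)\<^sup>2)"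
      using i by simp
    have "\<bar>x * y\<bar> \<le> x\<^sup>2 + y\<^sup>2" for x y :: real
    proof -
      have "2 * \<bar>x * y\<bar> \<le> x\<^sup>2 + y\<^sup>2"
        using sum_squares_bound[of "\<bar>x\<bar>" "\<bar>y\<bar>"] by (simp add: abs_mult)
      with abs_ge_zero[of "x * y"] show ?thesis by linarith
    qed
    then show "AE \<omega> in P. norm (f \<omega> * g \<omega>) \<le> norm ((f \<omega>)\<^sup>2 + (g \<omega>)\<^sup>2)"
      by simp
  qed simp
  have mfg: "(\<lambda>\<omega>. f \<omega> * g \<omega>) \<in> borel_measurable (past P w k)"
    "(\<lambda>\<omega>. (g \<omega>)\<^sup>2) \<in> borel_measurable (past P w k)"
    using m by simp_all
  have "expectation (\<lambda>\<omega>. (f \<omega>)\<^sup>2 + (g \<omega>)\<^sup>2)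
      = expectation (\<lambda>\<omega>. (f \<omega>)\<^sup>2 + 2 * (w k \<omega> * (f \<omega> * g \<omega>)) + (w k \<omega>)\<^sup>2 * (g \<omega>)\<^sup>2)"
    using noise_times_integrable[OF mfg(1) fg] noise_times_expectation[OF mfg(1) fg]
      noise_square_times_integrable[OF mfg(2) i(2)] noise_square_times_expectation[OF mfg(2) i(2)] i
    by simp
  also have "\<dots> = expectation (\<lambda>\<omega>. (f \<omega> + w k \<omega> * g \<omega>)\<^sup>2)"
    by (simp add: power2_eq_square algebra_simps)
  also have "\<dots> = expectation (\<lambda>\<omega>. 0)"
    using zero by (intro integral_cong_AE) auto
  finally have "expectation (\<lambda>\<omega>. (f \<omega>)\<^sup>2 + (g \<omega>)\<^sup>2) = 0" by simp
  then have "AE \<omega> in P. (f \<omega>)\<^sup>2 + (g \<omega>)\<^sup>2 = 0"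
    using i by (subst (asm) integral_nonneg_eq_0_iff_AE) auto
  then show ?thesis
    by (simp add: sum_power2_eq_zero_iff)
qed

lemma adapted_L2_step:
  assumes "f \<in> adapted_L2 k" "g \<in> adapted_L2 k"
  shows "(\<lambda>\<omega>. f \<omega> + w k \<omega> *\<^sub>R g \<omega>) \<in> adapted_L2 (Suc k)"
  using assms by (intro adapted_L2_add adapted_L2_noise) (auto intro: adapted_L2_mono)

lemma adapted_L2_vmult [intro]: "f \<in> adapted_L2 k \<Longrightarrow> (\<lambda>\<omega>. f \<omega> v* (X :: real^'m^'n)) \<in> adapted_L2 k"
  using adapted_L2_mult[of f k "transpose X"] by simp

lemma adapted_L2_funpow [intro]:
  "f \<in> adapted_L2 k \<Longrightarrow> (\<lambda>\<omega>. (((*v) (X :: real^'n^'n)) ^^ j) (f \<omega>)) \<in> adapted_L2 k"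
  by (induction j) (auto intro: adapted_L2_mult)

lemma adapted_L2_merge_vec [intro]:
  assumes "f \<in> adapted_L2 k" "g \<in> adapted_L2 k"
  shows "(\<lambda>\<omega>. merge_vec \<iota> (f \<omega>) (g \<omega>)) \<in> adapted_L2 k"
  using adapted_L2_add[OF adapted_L2_linear[OF linear_merge_vec(1)[of \<iota>] assms(1)]
      adapted_L2_linear[OF linear_merge_vec(2)[of \<iota>] assms(2)]]
  by (subst merge_vec_split)

lemma adapted_L2_inner [intro]: "f \<in> adapted_L2 k \<Longrightarrow> (\<lambda>\<omega>. a \<bullet> f \<omega>) \<in> adapted_L2 k"
  by (rule adapted_L2_linear[of "(\<bullet>) a"]) (auto intro: bounded_linear.linear bounded_linear_inner_right)

text \<open>Peeling off the last factor conjugates the inner matrix \<open>Q\<close> by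
  \<open>C1 + w(i) C1b\<close>, and the mean of this conjugate is \<open>lyap C1 C1b Q\<close>;
  hence the induction over arbitrary \<open>Q\<close>. Averaging over \<open>w i\<close> uses
  measurability and integrability, so these are carried along.\<close>

lemma noise_prod_form:
  fixes Q :: "real^'l^'l"
  shows "(\<lambda>\<omega>. noise_prod w C1 C1b i \<omega> ** Q ** transpose (noise_prod w C1 C1b i \<omega>))
            \<in> borel_measurable (past P w i)" (is "?meas i Q")
    and "integrable P (\<lambda>\<omega>. noise_prod w C1 C1b i \<omega> ** Q ** transpose (noise_prod w C1 C1b i \<omega>))"
      (is "?int i Q")
    and "expectation (\<lambda>\<omega>. noise_prod w C1 C1b i \<omega> ** Q ** transpose (noise_prod w C1 C1b i \<omega>))
           = (lyap C1 C1b ^^ i) Q" (is "?exp i Q")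
proof -
  have "?meas i Q \<and> ?int i Q \<and> ?exp i Q"
  proof (induction i arbitrary: Q)
    case 0
    show ?case by (simp add: prob_space)
  next
    case (Suc i)
    define f where "f R \<omega> = noise_prod w C1 C1b i \<omega> ** R ** transpose (noise_prod w C1 C1b i \<omega>)" for R \<omega>
    have f: "f R \<in> borel_measurable (past P w i)" "integrable P (f R)"
      "expectation (f R) = (lyap C1 C1b ^^ i) R" for R
      using Suc.IH[of R] unfolding f_def by auto
    \<comment> \<open>Coefficients of 1, \<open>w i\<close> and its square in the conjugated matrix.
      The middle term has mean zero, and \<open>R0 + R2\<close> is
      \<open>lyap C1 C1b Q\<close>.\<close>
    define R0 where "R0 = C1 ** Q ** transpose C1"
    define R1 where "R1 = C1 ** Q ** transpose C1b + C1b ** Q ** transpose C1"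
    define R2 where "R2 = C1b ** Q ** transpose C1b"
    have split: "noise_prod w C1 C1b (Suc i) \<omega> ** Q ** transpose (noise_prod w C1 C1b (Suc i) \<omega>)
        = f R0 \<omega> + w i \<omega> *\<^sub>R f R1 \<omega> + (w i \<omega>)\<^sup>2 *\<^sub>R f R2 \<omega>" for \<omega>
      unfolding matrix_eq f_def R0_def R1_def R2_def
      by (simp add: matrix_transpose_mul matrix_vector_mult_add_rdistrib matrix_vector_right_distrib
          vector_matrix_left_distrib vector_matrix_mult_add_rdistrib scaleR_vector_matrix_assoc
          vector_scaleR_matrix_ac scaleR_matrix_vector_assoc[symmetric] matrix_vector_mult_scaleR
          power2_eq_square scaleR_right_distrib
          flip: matrix_vector_mul_assoc vector_matrix_mul_assoc)
    have "(\<lambda>\<omega>. f R0 \<omega> + w i \<omega> *\<^sub>R f R1 \<omega> + (w i \<omega>)\<^sup>2 *\<^sub>R f R2 \<omega>) \<in> borel_measurable (past P w (Suc i))"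
      using measurable_past_mono[OF f(1), of "Suc i"] noise_measurable_past[of i "Suc i"] by simp
    moreover have "integrable P (\<lambda>\<omega>. f R0 \<omega> + w i \<omega> *\<^sub>R f R1 \<omega> + (w i \<omega>)\<^sup>2 *\<^sub>R f R2 \<omega>)"
      using f noise_times_integrable[OF f(1,2)] noise_square_times_integrable[OF f(1,2)] by simp
    moreover have "expectation (\<lambda>\<omega>. f R0 \<omega> + w i \<omega> *\<^sub>R f R1 \<omega> + (w i \<omega>)\<^sup>2 *\<^sub>R f R2 \<omega>)
        = (lyap C1 C1b ^^ Suc i) Q"
    proof -
      have "expectation (\<lambda>\<omega>. f R0 \<omega> + w i \<omega> *\<^sub>R f R1 \<omega> + (w i \<omega>)\<^sup>2 *\<^sub>R f R2 \<omega>)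
          = expectation (f R0) + expectation (f R2)"
        using f(2) noise_times_integrable[OF f(1,2), of R1] noise_times_expectation[OF f(1,2), of R1]
          noise_square_times_integrable[OF f(1,2), of R2] noise_square_times_expectation[OF f(1,2), of R2]
        by simp
      also have "\<dots> = expectation (\<lambda>\<omega>. f R0 \<omega> + f R2 \<omega>)"
        using f(2) by simp
      also have "(\<lambda>\<omega>. f R0 \<omega> + f R2 \<omega>) = f (lyap C1 C1b Q)"
        by (simp add: fun_eq_iff f_def lyap_def R0_def R2_def matrix_add_ldistrib matrix_eq
            matrix_vector_mult_add_rdistrib matrix_vector_right_distrib flip: matrix_vector_mul_assoc)
      finally show ?thesis
        unfolding f(3) by (simp add: funpow_swap1)
    qed
    ultimately show ?case
      unfolding split by blast
  qed
  then show "?meas i Q" "?int i Q" "?exp i Q" by auto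
qed

lemma gramian_eq: "gramian P w C1 C1b H D N = word_gramian C1 C1b (H ** D) (Suc N)"
proof -
  have "noise_prod w C1 C1b i \<omega> ** H ** D ** transpose D ** transpose H ** transpose (noise_prod w C1 C1b i \<omega>)
      = noise_prod w C1 C1b i \<omega> ** (H ** D ** transpose (H ** D)) ** transpose (noise_prod w C1 C1b i \<omega>)" for i \<omega>
    by (simp add: matrix_transpose_mul matrix_mul_assoc)
  then show ?thesis
    by (simp only: gramian_def noise_prod_form(3) word_gramian_def atLeast0AtMost lessThan_Suc_atMost)
qed

text \<open>Backward induction over time: orthogonality of past and noise annihilates
  \<open>Y\<close> and \<open>Z\<close> along unobservable directions, and invariance together with
  \<open>a v* E = 0\<close> gives the claim one step earlier. The terminal hypothesis covers all
  unobservable vectors, since \<open>a\<close> is replaced by \<open>a v* C1\<close> and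
  \<open>a v* C1b\<close>.\<close>

lemma unobservable_AE_zero_backward:
  assumes step: "\<And>k \<omega>. k < n \<Longrightarrow> X (Suc k) \<omega> = Y k \<omega> + w k \<omega> *\<^sub>R Z k \<omega>"
    and expand: "\<And>k \<omega>. k < n \<Longrightarrow> X k \<omega> = C1 *v Y k \<omega> + C1b *v Z k \<omega> + E *v v k \<omega>"
    and adapted: "\<And>k. k < n \<Longrightarrow> Y k \<in> adapted_L2 k" "\<And>k. k < n \<Longrightarrow> Z k \<in> adapted_L2 k"
    and final: "\<And>a. a \<in> unobservable C1 C1b E \<Longrightarrow> AE \<omega> in P. a \<bullet> X n \<omega> = 0"
    and a: "a \<in> unobservable C1 C1b E"
  shows "AE \<omega> in P. a \<bullet> X 0 \<omega> = 0"
  using assms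
proof (induction n arbitrary: a)
  case 0
  then show ?case by simp
next
  case (Suc n)
  have zero: "AE \<omega> in P. a \<bullet> Y n \<omega> = 0 \<and> a \<bullet> Z n \<omega> = 0" if "a \<in> unobservable C1 C1b E" for a
  proof (rule AE_zero_if_noise_combination_zero)
    show "(\<lambda>\<omega>. a \<bullet> Y n \<omega>) \<in> adapted_L2 n" "(\<lambda>\<omega>. a \<bullet> Z n \<omega>) \<in> adapted_L2 n"
      using Suc.prems(3,4) by auto
    show "AE \<omega> in P. a \<bullet> Y n \<omega> + w n \<omega> * (a \<bullet> Z n \<omega>) = 0"
      using Suc.prems(5)[OF that] Suc.prems(1)[of n] by (simp add: inner_right_distrib)
  qed
  have "AE \<omega> in P. a \<bullet> X n \<omega> = 0" if a: "a \<in> unobservable C1 C1b E" for a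
    using zero[OF unobservableD(2)[OF a]] zero[OF unobservableD(3)[OF a]]
  proof eventually_elim
    case (elim \<omega>)
    have "a \<bullet> X n \<omega> = (a v* C1) \<bullet> Y n \<omega> + (a v* C1b) \<bullet> Z n \<omega> + (a v* E) \<bullet> v n \<omega>"
      using Suc.prems(2)[of n] by (simp add: inner_right_distrib dot_lmul_matrix)
    with elim show ?case
      using unobservableD(1)[OF a] by simp
  qed
  with Suc show ?case by (metis less_SucI)
qed

end

section \<open>The controlled system\<close>

locale controlled_system = white_noise P w
  for P :: "'a measure" and w :: "nat \<Rightarrow> 'a \<Rightarrow> real" +
  fixes A Ab :: "real^'n^'n" and B Bb :: "real^'m^'n" and H :: "real^'n^'l"
    and M :: "real^'m^'m" and \<iota> :: "'n \<Rightarrow> 'm"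
    and L C Cb :: "real^'n^'n" and F D :: "real^'m^'n"
    and C1 C1b :: "real^'l^'l"
  assumes full_rank: "rank H = CARD('l)"
    and inj: "inj \<iota>"
    and M: "invertible M"
    and Bb_blocks: "left_block \<iota> (Bb ** M) = mat 1" "right_block \<iota> (Bb ** M) = 0"
    and B_blocks: "L = left_block \<iota> (B ** M)" "F = right_block \<iota> (B ** M)"
    and S: "invertible (A - L ** Ab)"
    and C: "C = matrix_inv (A - L ** Ab)"
    and Cb: "Cb = - (matrix_inv (A - L ** Ab) ** L)"
    and D: "D = - (matrix_inv (A - L ** Ab) ** F)"
    and intertwine: "H ** C = C1 ** H" "H ** Cb = C1b ** H"
begin

abbreviation "E \<equiv> H ** D"
abbreviation "K \<equiv> matrix_inv C1"
abbreviation "x_state \<equiv> state A Ab B Bb w"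

section \<open>Inverting one step of the system\<close>

lemma H_right_inverse: obtains J where "H ** J = mat 1"
  using full_rank by (auto simp: full_rank_surjective matrix_right_invertible_surjective[symmetric])

lemma C_mult: "C *v ((A - L ** Ab) *v x) = x"
  using matrix_inv_mult(2)[OF S] unfolding C by (simp add: matrix_vector_mul_assoc)

lemma C1_H: "C1 *v (H *v x) = H *v (C *v x)" and C1b_H: "C1b *v (H *v x) = H *v (Cb *v x)"
  using intertwine by (simp_all add: matrix_vector_mul_assoc)

text \<open>With \<open>J\<close> a right inverse of \<open>H\<close>, the relation
  \<open>H C = C1 H\<close> yields \<open>H (A - L Ab) J y\<close> as a preimage of
  \<open>y\<close>; a surjective square matrix is invertible.\<close>

lemma C1_invertible: "invertible C1"
proof -
  obtain J where J: "H ** J = mat 1" by (rule H_right_inverse)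
  have "C1 *v (H *v ((A - L ** Ab) *v (J *v y))) = y" for y
    using matrix_vector_mul_assoc[of H J y] by (simp add: C1_H C_mult J)
  then have "surj ((*v) C1)" by (rule surjI)
  then show ?thesis
    by (simp add: invertible_right_inverse matrix_right_invertible_surjective)
qed

lemma K_mult: "K *v (C1 *v y) = y" "C1 *v (K *v y) = y"
  using matrix_inv_mult(2)[OF C1_invertible] matrix_inv_mult(1)[OF C1_invertible]
  by (simp_all add: matrix_vector_mul_assoc)

lemma M_mult: "M *v (matrix_inv M *v a) = a"
  using matrix_inv_mult(1)[OF M] by (simp add: matrix_vector_mul_assoc)

text \<open>In the coordinates \<open>a\<close> of the control, \<open>Bb u = p\<close> and
  \<open>B u = L p + F a\<close>. Applying \<open>C\<close> to the drift and moving it past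
  \<open>H\<close> by intertwining gives the backward form of one step.\<close>

lemma C1_drift:
  "C1 *v (H *v (A *v x + B *v u))
    = H *v x - C1b *v (H *v (Ab *v x + Bb *v u)) - E *v (matrix_inv M *v u)"
proof -
  define a where "a = matrix_inv M *v u"
  define p where "p = (\<chi> i. a $ \<iota> i)"
  have "B *v u = (B ** M) *v a" "Bb *v u = (Bb ** M) *v a"
    by (simp_all add: a_def M_mult flip: matrix_vector_mul_assoc)
  then have u: "B *v u = L *v p + F *v a" "Bb *v u = p"
    using block_mult[OF inj, of "B ** M" a] block_mult[OF inj, of "Bb ** M" a]
    unfolding B_blocks Bb_blocks p_def by simp_all
  \<comment> \<open>Adding and subtracting \<open>L Ab x\<close> produces the invertible matrix
    \<open>A - L ** Ab\<close>, and \<open>L\<close> then acts on the whole diffusion term.\<close>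
  have "A *v x + B *v u = (A - L ** Ab) *v x + L *v (Ab *v x + p) + F *v a"
    unfolding u by (simp add: matrix_vector_mult_diff_rdistrib matrix_vector_right_distrib
        flip: matrix_vector_mul_assoc)
  then have "C *v (A *v x + B *v u) = x + C *v (L *v (Ab *v x + Bb *v u)) + C *v (F *v a)"
    by (simp add: matrix_vector_right_distrib C_mult u)
  moreover have "C *v (L *v z) = - (Cb *v z)" "C *v (F *v a) = - (D *v a)" for z
    by (simp_all add: Cb D C matrix_vector_mul_assoc)
       (simp_all add: matrix_vector_mult_def vec_eq_iff sum_negf)
  ultimately have "C *v (A *v x + B *v u) = x - Cb *v (Ab *v x + Bb *v u) - D *v a"
    by simp
  then show ?thesis
    unfolding C1_H C1b_H a_def[symmetric]
    by (simp add: matrix_vector_mult_diff_distrib flip: matrix_vector_mul_assoc)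
qed

section \<open>Necessity: unobservable directions under null steering\<close>

lemma state_adapted:
  assumes u: "u \<in> l2_adapted P w N" and k: "k \<le> Suc N"
  shows "x_state x0 u k \<in> adapted_L2 k"
  using k
proof (induction k)
  case (Suc k)
  then have x: "x_state x0 u k \<in> adapted_L2 k" and "u k \<in> adapted_L2 k"
    using u by (auto simp: l2_adapted_iff)
  then have "(\<lambda>\<omega>. A *v x_state x0 u k \<omega> + B *v u k \<omega>) \<in> adapted_L2 k"
    "(\<lambda>\<omega>. Ab *v x_state x0 u k \<omega> + Bb *v u k \<omega>) \<in> adapted_L2 k"
    by (auto intro!: adapted_L2_add adapted_L2_mult)
  then show ?case
    by (simp add: adapted_L2_step)
qed simp

lemma steers_zero_unobservable:
  assumes "steers P w A Ab B Bb H N y (\<lambda>\<omega>. 0)" and a: "a \<in> unobservable C1 C1b E"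
  shows "a \<bullet> y = 0"
proof -
  obtain u x0 where u: "u \<in> l2_adapted P w N" and y: "H *v x0 = y"
    and final: "AE \<omega> in P. H *v x_state x0 u (Suc N) \<omega> = 0"
    using assms(1) unfolding steers_def by auto
  define X where "X k \<omega> = H *v x_state x0 u k \<omega>" for k \<omega>
  define Y where "Y k \<omega> = H *v (A *v x_state x0 u k \<omega> + B *v u k \<omega>)" for k \<omega>
  define Z where "Z k \<omega> = H *v (Ab *v x_state x0 u k \<omega> + Bb *v u k \<omega>)" for k \<omega>
  have "AE \<omega> in P. a \<bullet> X 0 \<omega> = 0"
  proof (rule unobservable_AE_zero_backward[where n="Suc N"])
    fix k \<omega> assume k: "k < Suc N"
    show "X (Suc k) \<omega> = Y k \<omega> + w k \<omega> *\<^sub>R Z k \<omega>"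
      by (simp add: X_def Y_def Z_def matrix_vector_right_distrib matrix_vector_mult_scaleR scaleR_right_distrib)
    show "X k \<omega> = C1 *v Y k \<omega> + C1b *v Z k \<omega> + E *v (matrix_inv M *v u k \<omega>)"
      unfolding X_def Y_def Z_def C1_drift by simp
    have "x_state x0 u k \<in> adapted_L2 k" "u k \<in> adapted_L2 k"
      using k u state_adapted[OF u, of k] by (auto simp: l2_adapted_iff)
    then show "Y k \<in> adapted_L2 k" "Z k \<in> adapted_L2 k"
      unfolding Y_def Z_def by (auto intro!: adapted_L2_add adapted_L2_mult)
  next
    show "AE \<omega> in P. b \<bullet> X (Suc N) \<omega> = 0" for b
      using final unfolding X_def by eventually_elim simp
  qed (fact a)
  \<comment> \<open>The initial state is deterministic, so this almost sure identity between
    constants holds outright.\<close>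
  then have "AE \<omega> in P. a \<bullet> y = 0"
    by (simp add: X_def y)
  then show ?thesis by simp
qed

section \<open>Sufficiency: construction of controls\<close>

text \<open>Turns diffusion \<open>Z\<close> and input \<open>v\<close> into free controls. Since
  \<open>C1\<close> is injective, the backward relation determines \<open>X (Suc k)\<close> from
  \<open>X k\<close>, so the measured state of the constructed system follows
  \<open>X\<close>.\<close>

lemma steersI:
  assumes Z: "\<And>k. k \<le> N \<Longrightarrow> Z k \<in> adapted_L2 k" and v: "\<And>k. k \<le> N \<Longrightarrow> v k \<in> adapted_L2 k"
    and init: "\<And>\<omega>. X 0 \<omega> = y"
    and expand: "\<And>k \<omega>. k \<le> N \<Longrightarrow>
      X k \<omega> = C1 *v (X (Suc k) \<omega> - w k \<omega> *\<^sub>R Z k \<omega>) + C1b *v Z k \<omega> + E *v v k \<omega>"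
    and final: "AE \<omega> in P. X (Suc N) \<omega> = \<xi> \<omega>"
  shows "steers P w A Ab B Bb H N y \<xi>"
proof -
  obtain J where "H ** J = mat 1" by (rule H_right_inverse)
  then have J: "H *v (J *v z) = z" for z by (simp add: matrix_vector_mul_assoc)
  \<comment> \<open>The first block in \<open>M\<close>-coordinates cancels \<open>Ab x\<close> and
    puts \<open>J Z\<close> in its place, so that the diffusion seen through \<open>H\<close> is
    \<open>Z\<close>.\<close>
  define ctrl where "ctrl k x \<omega> = M *v merge_vec \<iota> (J *v Z k \<omega> - Ab *v x) (v k \<omega>)" for k x \<omega>
  \<comment> \<open>The control is a feedback of the state, so the closed-loop state is defined
    first and \<open>u\<close> is read off from it.\<close>
  define x where "x = rec_nat (\<lambda>\<omega>. J *v y)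
    (\<lambda>k xk \<omega>. (A *v xk \<omega> + B *v ctrl k (xk \<omega>) \<omega>) + w k \<omega> *\<^sub>R (Ab *v xk \<omega> + Bb *v ctrl k (xk \<omega>) \<omega>))"
  define u where "u k \<omega> = ctrl k (x k \<omega>) \<omega>" for k \<omega>
  have x: "x_state (J *v y) u k = x k" for k
    by (induction k) (simp_all add: x_def u_def)
  have Bb_u: "Ab *v x k \<omega> + Bb *v u k \<omega> = J *v Z k \<omega>" for k \<omega>
    using mult_merge_vec[OF inj, of "Bb ** M"]
    by (simp add: u_def ctrl_def matrix_vector_mul_assoc Bb_blocks)
  \<comment> \<open>\<open>F\<close>, hence \<open>D\<close>, has zero columns on the range of
    \<iota>, so the block that sets \<open>Z\<close> does not enter the input term.\<close>
  have D_merge: "D *v merge_vec \<iota> p q = D *v q" for p q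
  proof -
    have "left_block \<iota> F = 0" "right_block \<iota> F = F"
      by (simp_all add: B_blocks left_block_def right_block_def vec_eq_iff)
    then have "F *v merge_vec \<iota> p q = F *v q"
      using mult_merge_vec[OF inj, of F] by simp
    moreover have "D *v a = - (C *v (F *v a))" for a
      by (simp add: D C matrix_vector_mul_assoc)
         (simp add: matrix_vector_mult_def vec_eq_iff sum_negf)
    ultimately show ?thesis by simp
  qed
  have HX: "H *v x k \<omega> = X k \<omega>" if "k \<le> Suc N" for k \<omega>
    using that
  proof (induction k)
    case 0
    then show ?case by (simp add: x_def J init)
  next
    case (Suc k)
    have "matrix_inv M *v u k \<omega> = merge_vec \<iota> (J *v Z k \<omega> - Ab *v x k \<omega>) (v k \<omega>)"
      using matrix_inv_mult(2)[OF M] by (simp add: u_def ctrl_def matrix_vector_mul_assoc)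
    then have "C1 *v (H *v (A *v x k \<omega> + B *v u k \<omega>)) = H *v x k \<omega> - C1b *v Z k \<omega> - E *v v k \<omega>"
      unfolding C1_drift Bb_u J by (simp add: D_merge flip: matrix_vector_mul_assoc)
    also have "\<dots> = C1 *v (X (Suc k) \<omega> - w k \<omega> *\<^sub>R Z k \<omega>)"
      using Suc expand[of k \<omega>] by simp
    finally have "H *v (A *v x k \<omega> + B *v u k \<omega>) = X (Suc k) \<omega> - w k \<omega> *\<^sub>R Z k \<omega>"
      by (metis K_mult(1))
    moreover have "H *v x (Suc k) \<omega> = H *v (A *v x k \<omega> + B *v u k \<omega>) + w k \<omega> *\<^sub>R Z k \<omega>"
      unfolding x[symmetric]
      by (simp add: x Bb_u matrix_vector_right_distrib[of H "A *v x k \<omega> + B *v u k \<omega>"]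
          matrix_vector_mult_scaleR J)
    ultimately show ?case by simp
  qed
  have "x k \<in> adapted_L2 k" if "k \<le> N" for k
    using that
  proof (induction k)
    case 0
    then show ?case by (simp add: x_def)
  next
    case (Suc k)
    then have xk: "x k \<in> adapted_L2 k" and zv: "Z k \<in> adapted_L2 k" "v k \<in> adapted_L2 k"
      using Z v by auto
    then have "u k \<in> adapted_L2 k"
      unfolding u_def ctrl_def by (auto intro!: adapted_L2_mult adapted_L2_merge_vec adapted_L2_diff)
    with xk have "(\<lambda>\<omega>. A *v x k \<omega> + B *v u k \<omega>) \<in> adapted_L2 k"
      "(\<lambda>\<omega>. Ab *v x k \<omega> + Bb *v u k \<omega>) \<in> adapted_L2 k"
      by (auto intro!: adapted_L2_add adapted_L2_mult)
    then have "(\<lambda>\<omega>. (A *v x k \<omega> + B *v u k \<omega>) + w k \<omega> *\<^sub>R (Ab *v x k \<omega> + Bb *v u k \<omega>)) \<in> adapted_L2 (Suc k)"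
      by (rule adapted_L2_step)
    then show ?case
      by (simp add: x_def u_def)
  qed
  then have "u \<in> l2_adapted P w N"
    unfolding l2_adapted_iff u_def ctrl_def using Z v
    by (auto intro!: adapted_L2_mult adapted_L2_merge_vec adapted_L2_diff)
  moreover have "AE \<omega> in P. H *v x_state (J *v y) u (N + 1) \<omega> = \<xi> \<omega>"
    using final HX[of "Suc N"] x[of "Suc N"] by (simp del: state.simps)
  ultimately show ?thesis
    unfolding steers_def using J by blast
qed

lemma steers_if_word_gramian_invertible:
  assumes G: "invertible (word_gramian C1 C1b E (Suc n))" and \<xi>: "\<xi> \<in> adapted_L2 s"
  shows "steers P w A Ab B Bb H (s + n) y \<xi>"
proof -
  let ?G = "word_gramian C1 C1b E"
  define T where "T = s + Suc n"
  \<comment> \<open>Index \<open>i\<close> stands for time \<open>s + i\<close>. The starting value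
    solves the matching equation at time \<open>s\<close> and is measurable there because \<xi>
    is.\<close>
  define r where "r = rec_nat
    (\<lambda>\<omega>. matrix_inv (?G (Suc n)) *v (((*v) K ^^ s) y - ((*v) C1 ^^ Suc n) (\<xi> \<omega>)))
    (\<lambda>i ri \<omega>. ri \<omega> v* C1 + w (s + i) \<omega> *\<^sub>R (ri \<omega> v* C1b))"
  have r0: "?G (Suc n) *v r 0 \<omega> = ((*v) K ^^ s) y - ((*v) C1 ^^ Suc n) (\<xi> \<omega>)" for \<omega>
    using matrix_inv_mult(1)[OF G] by (simp add: r_def matrix_vector_mul_assoc del: funpow.simps)
  have r_Suc: "r (Suc i) \<omega> = r i \<omega> v* C1 + w (s + i) \<omega> *\<^sub>R (r i \<omega> v* C1b)" for i \<omega>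
    by (simp add: r_def)
  have r: "r i \<in> adapted_L2 (s + i)" for i
  proof (induction i)
    case 0
    show ?case
      using \<xi> by (auto simp add: r_def simp del: funpow.simps intro!: adapted_L2_mult adapted_L2_diff adapted_L2_funpow)
  next
    case (Suc i)
    have "(\<lambda>\<omega>. r i \<omega> v* C1 + w (s + i) \<omega> *\<^sub>R (r i \<omega> v* C1b)) \<in> adapted_L2 (Suc (s + i))"
      using Suc by (intro adapted_L2_step adapted_L2_vmult)
    then show ?case by (simp flip: r_Suc)
  qed
  \<comment> \<open>At \<open>k = T\<close> the Gramian has index 0 and vanishes, which leaves
    \<xi>.\<close>
  define X where "X k \<omega> = (if k < s then ((*v) K ^^ k) y
    else ((*v) C1 ^^ (T - k)) (\<xi> \<omega>) + ?G (T - k) *v r (k - s) \<omega>)" for k \<omega>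
  \<comment> \<open>The Gramian is that of \<open>X (Suc k)\<close>, one index below that of
    \<open>X k\<close>, so that the noise terms of \<open>X (Suc k)\<close> and of
    \<open>w k\<close> times \<open>Z k\<close> cancel.\<close>
  define Z where "Z k \<omega> = (if k < s then 0 else ?G (T - Suc k) *v (r (k - s) \<omega> v* C1b))" for k \<omega>
  define v where "v k \<omega> = (if k < s then 0 else r (k - s) \<omega> v* E)" for k \<omega>
  have Xs: "X k \<omega> = ((*v) K ^^ k) y" if "k \<le> s" for k \<omega>
    using that r0[of \<omega>] unfolding X_def T_def by (cases "k = s") (simp_all del: funpow.simps)
  show ?thesis
  proof (rule steersI)
    fix k assume "k \<le> s + n"
    show "Z k \<in> adapted_L2 k" "v k \<in> adapted_L2 k"
      using r[of "k - s"] unfolding Z_def v_def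
      by (cases "k < s"; auto intro!: adapted_L2_mult adapted_L2_vmult)+
  next
    show "X 0 \<omega> = y" for \<omega>
      by (simp add: Xs)
  next
    fix k \<omega> assume k: "k \<le> s + n"
    show "X k \<omega> = C1 *v (X (Suc k) \<omega> - w k \<omega> *\<^sub>R Z k \<omega>) + C1b *v Z k \<omega> + E *v v k \<omega>"
    proof (cases "k < s")
      case True
      then show ?thesis by (simp add: Xs Z_def v_def K_mult)
    next
      case False
      define i where "i = k - s"
      have i: "k = s + i" "i \<le> n" using False k by (auto simp: i_def)
      have T: "T - k = Suc (n - i)" "T - Suc k = n - i" "Suc k - s = Suc i" using i by (auto simp: T_def)
      have X: "X k \<omega> = C1 *v ((*v) C1 ^^ (n - i)) (\<xi> \<omega>) + ?G (Suc (n - i)) *v r i \<omega>"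
        "X (Suc k) \<omega> = ((*v) C1 ^^ (n - i)) (\<xi> \<omega>) + ?G (n - i) *v r (Suc i) \<omega>"
        and Zv: "Z k \<omega> = ?G (n - i) *v (r i \<omega> v* C1b)" "v k \<omega> = r i \<omega> v* E"
        using False T i by (simp_all add: X_def Z_def v_def)
      have "X (Suc k) \<omega> - w k \<omega> *\<^sub>R Z k \<omega> = ((*v) C1 ^^ (n - i)) (\<xi> \<omega>) + ?G (n - i) *v (r i \<omega> v* C1)"
        unfolding X Zv r_Suc by (simp add: i(1) matrix_vector_right_distrib matrix_vector_mult_scaleR)
      then show ?thesis
        unfolding X(1) Zv
        by (simp add: word_gramian_Suc matrix_vector_mult_add_rdistrib lyap_mult matrix_vector_right_distrib
            algebra_simps flip: matrix_vector_mul_assoc)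
    qed
  next
    show "AE \<omega> in P. X (Suc (s + n)) \<omega> = \<xi> \<omega>"
      by (simp add: X_def T_def)
  qed
qed

text \<open>Adaptedness of \<open>x\<close> is imposed only up to time \<open>N\<close>. Solving the
  last backward step through \<open>K\<close> expresses \<xi> almost surely by \<open>x N\<close>,
  \<open>z N\<close> and \<open>w N\<close>, which gives a version \<eta> in the past of
  \<open>Suc N\<close>.\<close>

lemma admissible_target_adapted:
  assumes "\<xi> \<in> admissible_targets P w C1 C1b"
  obtains s \<eta> where "s > 0" "\<eta> \<in> adapted_L2 s" "AE \<omega> in P. \<eta> \<omega> = \<xi> \<omega>"
proof -
  obtain N x z where N: "N > 0" and xz: "x \<in> l2_adapted P w N" "z \<in> l2_adapted P w N"
    and final: "AE \<omega> in P. x (N + 1) \<omega> = \<xi> \<omega>"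
    and eq: "AE \<omega> in P. x N \<omega> = C1 *v x (N + 1) \<omega> + C1b *v z N \<omega> - C1 *v (w N \<omega> *\<^sub>R z N \<omega>)"
    using assms unfolding admissible_targets_def bsde_solvable_def by blast
  define \<eta> where "\<eta> \<omega> = K *v (x N \<omega> - C1b *v z N \<omega> + C1 *v (w N \<omega> *\<^sub>R z N \<omega>))" for \<omega>
  have "x N \<in> adapted_L2 N" "z N \<in> adapted_L2 N"
    using xz by (auto simp: l2_adapted_iff)
  then have "\<eta> \<in> adapted_L2 (Suc N)"
    unfolding \<eta>_def
    by (intro adapted_L2_mult adapted_L2_add adapted_L2_diff adapted_L2_noise) (auto intro: adapted_L2_mono)
  moreover have "AE \<omega> in P. \<eta> \<omega> = \<xi> \<omega>"
    using final eq
  proof eventually_elim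
    case (elim \<omega>)
    then have "x N \<omega> - C1b *v z N \<omega> + C1 *v (w N \<omega> *\<^sub>R z N \<omega>) = C1 *v \<xi> \<omega>" by simp
    then show ?case by (simp add: \<eta>_def K_mult)
  qed
  ultimately show ?thesis using that by blast
qed

text \<open>The feedback reaches the adapted version \<eta>, and almost sure equality transfers this
  to \<xi>. The horizon \<open>s + n\<close> is positive since \<open>s\<close> is.\<close>

lemma controllable_if_unobservable_trivial:
  assumes "unobservable C1 C1b E = {0}"
  shows "partially_exactly_controllable P w A Ab B Bb H C1 C1b"
  unfolding partially_exactly_controllable_def
proof (intro allI impI ballI)
  fix y \<xi> assume "\<xi> \<in> admissible_targets P w C1 C1b"
  then obtain s \<eta> where s: "s > 0" "\<eta> \<in> adapted_L2 s" and eq: "AE \<omega> in P. \<eta> \<omega> = \<xi> \<omega>"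
    by (rule admissible_target_adapted)
  obtain n where "invertible (word_gramian C1 C1b E (Suc n))"
    using assms unfolding word_gramian_invertible_iff[symmetric] by blast
  then have "steers P w A Ab B Bb H (s + n) y \<eta>"
    using s(2) by (rule steers_if_word_gramian_invertible)
  then obtain u x0 where "u \<in> l2_adapted P w (s + n)" "H *v x0 = y"
    and "AE \<omega> in P. H *v x_state x0 u (s + n + 1) \<omega> = \<eta> \<omega>"
    unfolding steers_def by blast
  moreover from this(3) eq have "AE \<omega> in P. H *v x_state x0 u (s + n + 1) \<omega> = \<xi> \<omega>"
    by eventually_elim simp
  ultimately have "steers P w A Ab B Bb H (s + n) y \<xi>"
    unfolding steers_def by blast
  with s(1) show "\<exists>N>0. steers P w A Ab B Bb H N y \<xi>"
    by (intro exI[of _ "s + n"]) simp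
qed

section \<open>Comparison of the four conditions\<close>

lemma zero_admissible: "(\<lambda>\<omega>. 0) \<in> admissible_targets P w C1 C1b"
proof -
  have "bsde_solvable P w C1 C1b 1 (\<lambda>\<omega>. 0)"
    unfolding bsde_solvable_def l2_adapted_iff
    by (intro exI[of _ "\<lambda>_ _. 0"]) simp
  then show ?thesis
    unfolding admissible_targets_def L2_def by auto
qed

text \<open>Steering the initial value \<open>a\<close> itself to zero makes \<open>a\<close>
  orthogonal to \<open>a\<close>.\<close>

lemma unobservable_trivial_if_null_controllable:
  assumes null: "partially_exactly_null_controllable P w A Ab B Bb H"
  shows "unobservable C1 C1b E = {0}"
proof -
  have "a = 0" if a: "a \<in> unobservable C1 C1b E" for a
  proof (rule ccontr)
    assume "a \<noteq> 0"
    then obtain N where "steers P w A Ab B Bb H N a (\<lambda>\<omega>. 0)"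
      using null unfolding partially_exactly_null_controllable_def by blast
    from steers_zero_unobservable[OF this a] \<open>a \<noteq> 0\<close> show False by simp
  qed
  then show ?thesis by (auto simp: unobservable_def)
qed

theorem equivalences:
  "(partially_exactly_null_controllable P w A Ab B Bb H \<longleftrightarrow>
    partially_exactly_controllable P w A Ab B Bb H C1 C1b) \<and>
   (partially_exactly_controllable P w A Ab B Bb H C1 C1b \<longleftrightarrow>
    (\<exists>N>0. invertible (gramian P w C1 C1b H D N))) \<and>
   ((\<exists>N>0. invertible (gramian P w C1 C1b H D N)) \<longleftrightarrow> word_rank C1 C1b H D = CARD('l))"
proof -
  have "partially_exactly_null_controllable P w A Ab B Bb H"
    if "partially_exactly_controllable P w A Ab B Bb H C1 C1b"
    using that zero_admissible
    unfolding partially_exactly_controllable_def partially_exactly_null_controllable_def by blast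
  \<comment> \<open>The remaining implications pass through triviality of
    \<open>unobservable\<close>, to which the Gramian and rank conditions are equivalent.\<close>
  then show ?thesis
    using controllable_if_unobservable_trivial unobservable_trivial_if_null_controllable
    unfolding gramian_eq word_gramian_invertible_iff word_rank_full_iff by blast
qed

end

theorem theorem4:
  fixes P :: "'a measure" and w :: "nat \<Rightarrow> 'a \<Rightarrow> real"
    and A Ab :: "real^'n^'n" and B Bb :: "real^'m^'n" and H :: "real^'n^'l"
    and M :: "real^'m^'m" and \<iota> :: "'n \<Rightarrow> 'm"
    and L C Cb :: "real^'n^'n" and F D :: "real^'m^'n"
    and C1 C1b :: "real^'l^'l"
  assumes "prob_space P" and "complete_measure P" and "unit_white_noise P w"
    and "rank H = CARD('l)"
    and "rank Bb = CARD('n)"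
    and "inj \<iota>"
    and "invertible M"
    and "left_block \<iota> (Bb ** M) = mat 1" and "right_block \<iota> (Bb ** M) = 0"
    and "L = left_block \<iota> (B ** M)" and "F = right_block \<iota> (B ** M)"
    and "invertible (A - L ** Ab)"
    and "C = matrix_inv (A - L ** Ab)"
    and "Cb = - (matrix_inv (A - L ** Ab) ** L)"
    and "D = - (matrix_inv (A - L ** Ab) ** F)"
    and "H ** C = C1 ** H" and "H ** Cb = C1b ** H"
  shows "(partially_exactly_null_controllable P w A Ab B Bb H \<longleftrightarrow>
          partially_exactly_controllable P w A Ab B Bb H C1 C1b) \<and>
         (partially_exactly_controllable P w A Ab B Bb H C1 C1b \<longleftrightarrow>
          (\<exists>N>0. invertible (gramian P w C1 C1b H D N))) \<and>
         ((\<exists>N>0. invertible (gramian P w C1 C1b H D N)) \<longleftrightarrow>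
          word_rank C1 C1b H D = CARD('l))"
proof -
  interpret prob_space P by fact
  interpret controlled_system P w A Ab B Bb H M \<iota> L C Cb F D C1 C1b
    using assms by unfold_locales
  show ?thesis by (rule equivalences)
qed

end
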